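(* Let $G$ be a graph on $n\ge 5$ vertices such that both $G$ and its complement $\overline{G}$ are connected. Then $$n+3\le mvc(G)+mvc(\overline{G})\le 2n.$$ Moreover, both bounds are sharp: for every $n\ge5$ there is a graph $G$ on $n$ vertices with $G$ and $\overline{G}$ connected and $mvc(G)+mvc(\overline G)=n+3$, and there is a graph $G$ on $n$ vertices with $G$ and $\overline{G}$ connected and $mvc(G)+mvc(\overline G)=2n$.
   Context: All graphs are simple, finite and undirected. A path in a vertex-colored graph is vertex-monochromatic if all its internal vertices have the same color (in particular, a path with at most one internal vertex is vertex-monochromatic). A vertex-coloring (not required to be proper) of a connected graph $G$ is an MVC-coloring if any two vertices of $G$ are joined by a vertex-monochromatic path. The monochromatic vertex-connection number $mvc(G)$ is the maximum number of colors used in an MVC-coloring of $G$. *)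

theory Defs
  imports "Graph_Theory.Graph_Theory"
begin

(* Simple finite undirected graphs are loop-free symmetric finite digraphs without
   parallel arcs, i.e. pair_graph: an edge uv is the pair of arcs (u,v), (v,u). *)

definition graph_complement :: "'a pair_pre_digraph \<Rightarrow> 'a pair_pre_digraph" where
  "graph_complement G =
     \<lparr> pverts = pverts G,
       parcs = {(u, v). u \<in> pverts G \<and> v \<in> pverts G \<and> u \<noteq> v \<and> (u, v) \<notin> parcs G} \<rparr>"

(* A path is the list of its vertices, including both end vertices. *)
definition internal_verts :: "'a list \<Rightarrow> 'a set" where
  "internal_verts p = set (butlast (tl p))"

definition vertex_monochromatic :: "('a \<Rightarrow> 'c) \<Rightarrow> 'a list \<Rightarrow> bool" where
  "vertex_monochromatic c p \<longleftrightarrow>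
     (\<forall>x \<in> internal_verts p. \<forall>y \<in> internal_verts p. c x = c y)"

definition MVC_coloring :: "'a pair_pre_digraph \<Rightarrow> ('a \<Rightarrow> 'c) \<Rightarrow> bool" where
  "MVC_coloring G c \<longleftrightarrow>
     (\<forall>u \<in> pverts G. \<forall>v \<in> pverts G.
        \<exists>p. vpath p (with_proj G) \<and> hd p = u \<and> last p = v \<and> vertex_monochromatic c p)"

(* Colors are natural numbers, which suffice since the vertex set is finite.  For a finite
   connected graph the maximum ranges over a finite set (bounded by the number of vertices)
   that is nonempty (constant colorings); for other graphs the value is meaningless. *)
definition mvc :: "'a pair_pre_digraph \<Rightarrow> nat" where
  "mvc G = Max {card (c ` pverts G) | c :: 'a \<Rightarrow> nat. MVC_coloring G c}"

end

theory Submission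
  imports Defs
begin

text \<open>
  For the lower bound, colour a connected dominating set \<open>S\<close> of a graph with one colour and
  give every other vertex a colour of its own.  Any two vertices are then joined by a path running
  inside \<open>S\<close>, so \<open>mvc\<close> is at least the number of vertices outside \<open>S\<close> plus one
  (\<open>mvc_ge_dominating\<close>).  If the diameter is at most two, the injective colouring is already
  admissible and \<open>mvc\<close> equals the order \<open>n\<close>.  If it is not, there are distinct non-adjacent
  vertices \<open>u, v\<close> without common neighbour; in the complement they form a
  connected dominating set, so the complement has \<open>mvc \<ge> n - 1\<close>
  (\<open>mvc_complement_ge\<close>).  Hence either one of the two graphs has \<open>mvc = n\<close>, and the other has
  \<open>mvc \<ge> 3\<close> because every connected graph on at least three vertices has a connected
  dominating set missing at least two vertices (\<open>ex_connected_dominating\<close>); or both have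
  \<open>mvc \<ge> n - 1\<close>, and \<open>2 * (n - 1) \<ge> n + 3\<close> precisely when \<open>n \<ge> 5\<close>.  The upper bound \<open>2 * n\<close>
  is trivial.

  The path on \<open>n\<close> vertices attains the lower bound: the only path between its two ends
  visits every vertex, so all inner vertices share one colour and at most three colours occur.
  The upper bound is attained when the graph and its complement both have diameter two, as
  happens for the 5-cycle with one vertex replaced by independent twins.
\<close>

section \<open>Complements and connectedness\<close>

lemma pverts_graph_complement [simp]: "pverts (graph_complement G) = pverts G"
  by (simp add: graph_complement_def)

lemma parcs_graph_complement:
  "(u, v) \<in> parcs (graph_complement G) \<longleftrightarrow>
     u \<in> pverts G \<and> v \<in> pverts G \<and> u \<noteq> v \<and> (u, v) \<notin> parcs G"
  by (simp add: graph_complement_def)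

lemma pair_graph_iff:
  "pair_graph G \<longleftrightarrow> finite (pverts G) \<and>
     (\<forall>u v. (u, v) \<in> parcs G \<longrightarrow> u \<in> pverts G \<and> v \<in> pverts G \<and> u \<noteq> v \<and> (v, u) \<in> parcs G)"
  (is "?L \<longleftrightarrow> ?R")
proof
  assume ?L
  then interpret pair_graph G .
  show ?R
    using pair_finite_verts in_arcsD1 in_arcsD2 no_loops' arcs_symmetric by metis
next
  assume R: ?R
  then have "parcs G \<subseteq> pverts G \<times> pverts G" by auto
  with R have "finite (parcs G)" by (metis finite_cartesian_product finite_subset)
  with R show ?L
    by unfold_locales (auto simp: symmetric_def intro!: symI)
qed

lemma pair_graph_finite: "pair_graph G \<Longrightarrow> finite (pverts G)"
  by (simp add: pair_graph_iff)

lemma pair_graph_arcD: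
  assumes "pair_graph G" "(u, v) \<in> parcs G"
  shows "(v, u) \<in> parcs G" "u \<in> pverts G" "v \<in> pverts G" "u \<noteq> v"
  using assms by (simp_all add: pair_graph_iff)

lemma pair_graph_complement:
  assumes "pair_graph G"
  shows "pair_graph (graph_complement G)"
  using assms by (auto simp: pair_graph_iff parcs_graph_complement)

lemma graph_complement_complement:
  assumes "pair_graph G"
  shows "graph_complement (graph_complement G) = G"
proof -
  have "parcs (graph_complement (graph_complement G)) = parcs G"
    using assms by (auto simp: pair_graph_iff parcs_graph_complement)
  then show ?thesis by (simp add: pair_pre_digraph.equality)
qed

text \<open>Cuts turn connectedness into the existence of a single arc.  This is the form needed to
  enlarge a vertex set step by step, and it is easy to verify for concrete graphs.\<close>

lemma connected_iff_cut:
  assumes "pair_graph G"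
  shows "connected (with_proj G) \<longleftrightarrow> pverts G \<noteq> {} \<and>
    (\<forall>T. T \<subset> pverts G \<and> T \<noteq> {} \<longrightarrow> (\<exists>a\<in>T. \<exists>b\<in>pverts G - T. (a, b) \<in> parcs G))"
    (is "_ \<longleftrightarrow> _ \<and> ?cut")
proof -
  interpret pair_graph G by fact
  have conn: "connected (with_proj G) \<longleftrightarrow>
      pverts G \<noteq> {} \<and> (\<forall>u\<in>pverts G. \<forall>v\<in>pverts G. u \<rightarrow>\<^sup>*\<^bsub>with_proj G\<^esub> v)"
    unfolding connected_def strongly_connected_def
    using reachable_mk_symmetric_eq[OF pair_sym_arcs] by simp
  show ?thesis
  proof
    assume c: "connected (with_proj G)"
    have ?cut
    proof (intro allI impI, rule ccontr)
      fix T assume T: "T \<subset> pverts G \<and> T \<noteq> {}"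
        and closed: "\<not> (\<exists>a\<in>T. \<exists>b\<in>pverts G - T. (a, b) \<in> parcs G)"
      then obtain u v where u: "u \<in> T" "u \<in> pverts G" and v: "v \<in> pverts G" "v \<notin> T" by blast
      then have "u \<rightarrow>\<^sup>*\<^bsub>with_proj G\<^esub> v" using c conn by blast
      then have "v \<in> T"
      proof (induction rule: reachable_induct)
        case (step x y)
        then show ?case using closed in_arcsD2[of x y] by auto
      qed (rule u(1))
      with v show False by blast
    qed
    then show "pverts G \<noteq> {} \<and> ?cut" using c conn by blast
  next
    assume cut: "pverts G \<noteq> {} \<and> ?cut"
    have "u \<rightarrow>\<^sup>*\<^bsub>with_proj G\<^esub> v" if u: "u \<in> pverts G" and v: "v \<in> pverts G" for u v
    proof (rule ccontr)
      assume nv: "\<not> u \<rightarrow>\<^sup>*\<^bsub>with_proj G\<^esub> v"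
      let ?T = "{w \<in> pverts G. u \<rightarrow>\<^sup>*\<^bsub>with_proj G\<^esub> w}"
      have "u \<in> ?T" using u by auto
      then have "?T \<subset> pverts G \<and> ?T \<noteq> {}" using v nv by blast
      then obtain a b where "a \<in> ?T" "b \<in> pverts G - ?T" "(a, b) \<in> parcs G" using cut by meson
      then show False using reachable_adj_trans by auto
    qed
    then show "connected (with_proj G)" using conn cut by blast
  qed
qed

definition diameter_le_2 :: "'a pair_pre_digraph \<Rightarrow> bool" where
  "diameter_le_2 G \<longleftrightarrow> (\<forall>u\<in>pverts G. \<forall>v\<in>pverts G.
     u = v \<or> (u, v) \<in> parcs G \<or> (\<exists>w. (u, w) \<in> parcs G \<and> (w, v) \<in> parcs G))"

lemma diameter_le_2_imp_connected:
  assumes "pair_graph G" "diameter_le_2 G" "pverts G \<noteq> {}"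
  shows "connected (with_proj G)"
proof -
  have "\<exists>a\<in>T. \<exists>b\<in>pverts G - T. (a, b) \<in> parcs G" if T: "T \<subset> pverts G" "T \<noteq> {}" for T
  proof -
    from T obtain u v where uv: "u \<in> T" "u \<in> pverts G" "v \<in> pverts G" "v \<notin> T" by blast
    then consider "(u, v) \<in> parcs G" | w where "(u, w) \<in> parcs G" "(w, v) \<in> parcs G"
      using assms(2) unfolding diameter_le_2_def by metis
    then show ?thesis
    proof cases
      case 1
      with uv show ?thesis by blast
    next
      case (2 w)
      then have "w \<in> pverts G" using pair_graph_arcD(3)[OF assms(1)] by blast
      with 2 uv show ?thesis by (cases "w \<in> T") blast+
    qed
  qed
  then show ?thesis using assms(3) connected_iff_cut[OF assms(1)] by simp
qed

section \<open>Colourings and their number of colours\<close>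

lemma finite_MVC_color_counts:
  assumes "finite (pverts G)"
  shows "finite {card (c ` pverts G) | c :: 'a \<Rightarrow> nat. MVC_coloring G c}"
  by (rule finite_subset[of _ "{..card (pverts G)}"]) (use assms card_image_le in auto)

lemma mvc_ge:
  fixes c :: "'a \<Rightarrow> nat"
  assumes "finite (pverts G)" "MVC_coloring G c"
  shows "card (c ` pverts G) \<le> mvc G"
  unfolding mvc_def using finite_MVC_color_counts[OF assms(1)] assms(2) by (intro Max_ge) auto

lemma mvc_le:
  fixes c :: "'a \<Rightarrow> nat"
  assumes "finite (pverts G)" "MVC_coloring G c"
    and "\<And>d :: 'a \<Rightarrow> nat. MVC_coloring G d \<Longrightarrow> card (d ` pverts G) \<le> k"
  shows "mvc G \<le> k"
  unfolding mvc_def using finite_MVC_color_counts[OF assms(1)] assms(2,3)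
  by (subst Max_le_iff) auto

lemma mvc_diameter_le_2:
  fixes G :: "'a pair_pre_digraph"
  assumes "pair_graph G" "diameter_le_2 G"
  shows "mvc G \<ge> card (pverts G)"
proof -
  have fin: "finite (pverts G)" using assms(1) by (rule pair_graph_finite)
  from finite_imp_inj_to_nat_seg[OF this] obtain f :: "'a \<Rightarrow> nat" where f: "inj_on f (pverts G)"
    by auto
  have "MVC_coloring G f" unfolding MVC_coloring_def
  proof (intro ballI)
    fix u v assume uv: "u \<in> pverts G" "v \<in> pverts G"
    then consider "u = v" | "u \<noteq> v" "(u, v) \<in> parcs G"
      | w where "u \<noteq> v" "(u, w) \<in> parcs G" "(w, v) \<in> parcs G"
      using assms(2) unfolding diameter_le_2_def by metis
    then show "\<exists>p. vpath p (with_proj G) \<and> hd p = u \<and> last p = v \<and> vertex_monochromatic f p"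
    proof cases
      case 1
      then show ?thesis using uv
        by (intro exI[of _ "[u]"])
          (auto simp: vpath_def vwalk_def vertex_monochromatic_def internal_verts_def)
    next
      case 2
      then show ?thesis using uv
        by (intro exI[of _ "[u, v]"])
          (auto simp: vpath_def vwalk_def vertex_monochromatic_def internal_verts_def)
    next
      case (3 w)
      then have "w \<in> pverts G" "u \<noteq> w" "w \<noteq> v"
        using pair_graph_arcD[OF assms(1)] by blast+
      then show ?thesis using 3 uv
        by (intro exI[of _ "[u, w, v]"])
          (auto simp: vpath_def vwalk_def vertex_monochromatic_def internal_verts_def)
    qed
  qed
  from mvc_ge[OF fin this] show ?thesis using card_image[OF f] by simp
qed

section \<open>Connected dominating sets\<close>

text \<open>The requirement that the connecting path is simple is built in, because the paths in the
  definition of an MVC-colouring are simple; it survives adding a vertex to \<open>S\<close>, as the new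
  vertex cannot occur in a path inside \<open>S\<close>.\<close>

definition connected_within :: "'a pair_pre_digraph \<Rightarrow> 'a set \<Rightarrow> bool" where
  "connected_within G S \<longleftrightarrow> (\<forall>u\<in>S. \<forall>v\<in>S.
     \<exists>p. vpath p (with_proj G) \<and> hd p = u \<and> last p = v \<and> set p \<subseteq> S)"

definition boundary :: "'a pair_pre_digraph \<Rightarrow> 'a set \<Rightarrow> 'a set" where
  "boundary G S = {v \<in> pverts G - S. \<exists>s\<in>S. (s, v) \<in> parcs G}"

lemma connected_within_singleton:
  assumes "v \<in> pverts G"
  shows "connected_within G {v}"
  unfolding connected_within_def using assms
  by (auto intro!: exI[of _ "[v]"] simp: vpath_def vwalk_def)

lemma vpath_Cons:
  assumes "vpath p (with_proj G)" "u \<in> pverts G" "(u, hd p) \<in> parcs G" "u \<notin> set p"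
  shows "vpath (u # p) (with_proj G)"
  using assms by (auto simp: vpath_def intro: vwalk_consI)

lemma vpath_snoc:
  assumes "vpath p (with_proj G)" "u \<in> pverts G" "(last p, u) \<in> parcs G" "u \<notin> set p"
  shows "vpath (p @ [u]) (with_proj G)"
  using assms by (auto simp: vpath_def vwalk_def vwalk_arcs_append)

lemma connected_within_insert:
  assumes G: "pair_graph G" and S: "connected_within G S" and b: "b \<in> boundary G S"
  shows "connected_within G (insert b S)"
  unfolding connected_within_def
proof (intro ballI)
  obtain s where s: "s \<in> S" "(s, b) \<in> parcs G" "(b, s) \<in> parcs G" "b \<in> pverts G" "b \<notin> S"
    using b pair_graph_arcD[OF G] unfolding boundary_def by blast
  have path: "\<exists>p. vpath p (with_proj G) \<and> hd p = u \<and> last p = v \<and> set p \<subseteq> S"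
    if "u \<in> S" "v \<in> S" for u v using S that unfolding connected_within_def by blast
  fix u v assume uv: "u \<in> insert b S" "v \<in> insert b S"
  consider "u = b" "v = b" | "u = b" "v \<in> S" | "u \<in> S" "v = b" | "u \<in> S" "v \<in> S" using uv by blast
  then show "\<exists>p. vpath p (with_proj G) \<and> hd p = u \<and> last p = v \<and> set p \<subseteq> insert b S"
  proof cases
    case 1
    then show ?thesis using s by (intro exI[of _ "[b]"]) (auto simp: vpath_def vwalk_def)
  next
    case 2
    obtain p where p: "vpath p (with_proj G)" "hd p = s" "last p = v" "set p \<subseteq> S"
      using path[OF s(1) 2(2)] by blast
    moreover from p have "p \<noteq> []" by (auto simp: vpath_def vwalk_def)
    moreover have "vpath (b # p) (with_proj G)" using p s by (intro vpath_Cons) auto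
    ultimately show ?thesis using 2 by (intro exI[of _ "b # p"]) auto
  next
    case 3
    obtain p where p: "vpath p (with_proj G)" "hd p = u" "last p = s" "set p \<subseteq> S"
      using path[OF 3(1) s(1)] by blast
    moreover from p have "p \<noteq> []" by (auto simp: vpath_def vwalk_def)
    moreover have "vpath (p @ [b]) (with_proj G)" using p s by (intro vpath_snoc) auto
    ultimately show ?thesis using 3 by (intro exI[of _ "p @ [b]"]) auto
  next
    case 4
    then show ?thesis using path[of u v] by blast
  qed
qed

text \<open>One colour suffices on \<open>S\<close>: a path between two vertices outside \<open>S\<close> steps
  into \<open>S\<close>, stays there, and steps out only at its end.\<close>

lemma dominating_MVC_coloring:
  assumes G: "pair_graph G" and S: "S \<subseteq> pverts G" "connected_within G S"
    and dom: "pverts G \<subseteq> S \<union> boundary G S"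
    and const: "\<And>x y. x \<in> S \<Longrightarrow> y \<in> S \<Longrightarrow> c x = c y"
  shows "MVC_coloring G c"
  unfolding MVC_coloring_def
proof (intro ballI)
  fix u v assume uv: "u \<in> pverts G" "v \<in> pverts G"
  have path: "\<exists>p. vpath p (with_proj G) \<and> hd p = u \<and> last p = v \<and> set p \<subseteq> S \<and> p \<noteq> []"
    if "u \<in> S" "v \<in> S" for u v
    using S that unfolding connected_within_def vpath_def vwalk_def by blast
  have enter: "\<exists>s\<in>S. (w, s) \<in> parcs G \<and> (s, w) \<in> parcs G" if "w \<in> pverts G" "w \<notin> S" for w
    using dom that pair_graph_arcD(1)[OF G] unfolding boundary_def by blast
  have mono: "vertex_monochromatic c p" if "internal_verts p \<subseteq> S" for p
    using that const unfolding vertex_monochromatic_def by blast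
  consider "u = v" | "u \<in> S" "v \<in> S" | "u \<in> S" "v \<notin> S" | "u \<notin> S" "v \<in> S"
    | "u \<noteq> v" "u \<notin> S" "v \<notin> S" by blast
  then show "\<exists>p. vpath p (with_proj G) \<and> hd p = u \<and> last p = v \<and> vertex_monochromatic c p"
  proof cases
    case 1
    then show ?thesis using uv
      by (intro exI[of _ "[u]"])
        (auto simp: vpath_def vwalk_def vertex_monochromatic_def internal_verts_def)
  next
    case 2
    from path[OF this] obtain p
      where p: "vpath p (with_proj G)" "hd p = u" "last p = v" "set p \<subseteq> S" by blast
    then have "internal_verts p \<subseteq> S"
      by (cases p) (auto simp: internal_verts_def dest: in_set_butlastD)
    with p mono show ?thesis by blast
  next
    case 3
    with enter uv obtain s where s: "s \<in> S" "(s, v) \<in> parcs G" by blast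
    from path[OF 3(1) s(1)] obtain p
      where p: "vpath p (with_proj G)" "hd p = u" "last p = s" "set p \<subseteq> S" "p \<noteq> []" by blast
    then have "vpath (p @ [v]) (with_proj G)" using s uv 3 by (intro vpath_snoc) auto
    moreover have "internal_verts (p @ [v]) \<subseteq> S"
      using p by (cases p) (auto simp: internal_verts_def)
    ultimately show ?thesis using p mono by (intro exI[of _ "p @ [v]"]) auto
  next
    case 4
    with enter uv obtain s where s: "s \<in> S" "(u, s) \<in> parcs G" by blast
    from path[OF s(1) 4(2)] obtain p
      where p: "vpath p (with_proj G)" "hd p = s" "last p = v" "set p \<subseteq> S" "p \<noteq> []" by blast
    then have "vpath (u # p) (with_proj G)" using s uv 4 by (intro vpath_Cons) auto
    moreover have "internal_verts (u # p) \<subseteq> S"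
      using p by (auto simp: internal_verts_def dest: in_set_butlastD)
    ultimately show ?thesis using p mono by (intro exI[of _ "u # p"]) auto
  next
    case 5
    with enter uv obtain s t where s: "s \<in> S" "(u, s) \<in> parcs G" and t: "t \<in> S" "(t, v) \<in> parcs G"
      by blast
    from path[OF s(1) t(1)] obtain p
      where p: "vpath p (with_proj G)" "hd p = s" "last p = t" "set p \<subseteq> S" "p \<noteq> []" by blast
    then have "vpath (u # p) (with_proj G)" using s uv 5 by (intro vpath_Cons) auto
    then have "vpath ((u # p) @ [v]) (with_proj G)" using p t uv 5 by (intro vpath_snoc) auto
    moreover have "internal_verts ((u # p) @ [v]) \<subseteq> S"
      using p by (auto simp: internal_verts_def)
    ultimately show ?thesis using p mono by (intro exI[of _ "(u # p) @ [v]"]) auto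
  qed
qed

lemma mvc_ge_dominating:
  fixes G :: "'a pair_pre_digraph"
  assumes G: "pair_graph G" and S: "S \<subseteq> pverts G" "S \<noteq> {}" "connected_within G S"
    and dom: "pverts G \<subseteq> S \<union> boundary G S"
  shows "mvc G \<ge> card (pverts G - S) + 1"
proof -
  have fin: "finite (pverts G)" using G by (rule pair_graph_finite)
  then have "finite (pverts G - S)" by simp
  from finite_imp_inj_to_nat_seg[OF this]
  obtain f :: "'a \<Rightarrow> nat" where f: "inj_on f (pverts G - S)" by auto
  define c where "c x = (if x \<in> S then 0 else Suc (f x))" for x
  have c: "MVC_coloring G c"
    by (rule dominating_MVC_coloring[OF G S(1,3) dom]) (simp add: c_def)
  have "c ` pverts G = insert 0 ((Suc \<circ> f) ` (pverts G - S))"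
    using S by (auto simp: c_def image_iff)
  then have "card (c ` pverts G) = Suc (card ((Suc \<circ> f) ` (pverts G - S)))"
    using fin by (simp add: image_iff)
  also have "card ((Suc \<circ> f) ` (pverts G - S)) = card (pverts G - S)"
    using f by (intro card_image comp_inj_on) auto
  finally show ?thesis using mvc_ge[OF fin c] by simp
qed

text \<open>Take an inclusion-maximal connected set with at least two boundary vertices.
  If it failed to dominate, some boundary vertex would have a neighbour outside the set and its
  boundary; moving that vertex into the set costs one boundary vertex and gains at least one.
  A vertex with two neighbours serves as a first such set.\<close>

lemma ex_connected_dominating:
  assumes G: "pair_graph G" and conn: "connected (with_proj G)" and n: "card (pverts G) \<ge> 3"
  obtains S where "S \<subseteq> pverts G" "S \<noteq> {}" "connected_within G S"
    "pverts G \<subseteq> S \<union> boundary G S" "card (pverts G - S) \<ge> 2"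
proof -
  have fin: "finite (pverts G)" using G by (rule pair_graph_finite)
  have sym: "(y, x) \<in> parcs G" "x \<in> pverts G" "y \<in> pverts G" "x \<noteq> y" if "(x, y) \<in> parcs G" for x y
    using pair_graph_arcD[OF G that] by auto
  have cut: "\<exists>a\<in>T. \<exists>b\<in>pverts G - T. (a, b) \<in> parcs G" if "T \<subseteq> pverts G" "T \<noteq> {}" "T \<noteq> pverts G" for T
    using conn that unfolding connected_iff_cut[OF G] by blast
  have finB: "finite (boundary G S)" for S using fin by (simp add: boundary_def)
  define good where "good S \<longleftrightarrow> S \<subseteq> pverts G \<and> S \<noteq> {} \<and> connected_within G S \<and>
    card (boundary G S) \<ge> 2" for S
  have "\<exists>S. good S"
  proof -
    obtain v where v: "v \<in> pverts G" using n by fastforce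
    have "card {v} \<noteq> card (pverts G)" using n by simp
    then have "{v} \<noteq> pverts G" by metis
    with cut[of "{v}"] v obtain w where w: "(v, w) \<in> parcs G" by blast
    have "card {v, w} \<noteq> card (pverts G)" using n by (simp add: card_insert_if)
    then have "{v, w} \<noteq> pverts G" by metis
    with cut[of "{v, w}"] sym[OF w] obtain a z
      where az: "a \<in> {v, w}" "z \<notin> {v, w}" "(a, z) \<in> parcs G" by blast
    \<comment> \<open>The end \<open>a\<close> of the arc leaving \<open>{v, w}\<close> has two neighbours: \<open>z\<close> and the other end \<open>b\<close> of
      the arc between \<open>v\<close> and \<open>w\<close>.\<close>
    define b where "b = (if a = v then w else v)"
    have b: "(a, b) \<in> parcs G" "b \<noteq> z" using az sym[OF w] w by (auto simp: b_def)
    have "{b, z} \<subseteq> boundary G {a}"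
      using b az sym[OF b(1)] sym[OF az(3)] by (auto simp: boundary_def)
    then have "card {b, z} \<le> card (boundary G {a})" by (intro card_mono finB)
    then have "good {a}"
      unfolding good_def using b sym[OF b(1)] connected_within_singleton[of a G] by simp
    then show ?thesis by blast
  qed
  moreover have "finite {S. good S}"
    by (rule finite_subset[of _ "Pow (pverts G)"]) (use fin in \<open>auto simp: good_def\<close>)
  ultimately obtain S where S: "good S" and max: "\<And>T. good T \<Longrightarrow> S \<subseteq> T \<Longrightarrow> S = T"
    using finite_has_maximal[of "{S. good S}"] by auto
  have dom: "pverts G \<subseteq> S \<union> boundary G S"
  proof (rule ccontr)
    let ?T = "S \<union> boundary G S"
    assume "\<not> pverts G \<subseteq> ?T"
    moreover have "?T \<subseteq> pverts G" using S by (auto simp: good_def boundary_def)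
    ultimately obtain b z where bz: "b \<in> ?T" "z \<in> pverts G - ?T" "(b, z) \<in> parcs G"
      using cut[of ?T] S by (auto simp: good_def)
    then have b: "b \<in> boundary G S" by (auto simp: boundary_def)
    let ?B = "insert z (boundary G S - {b})"
    have "?B \<subseteq> boundary G (insert b S)"
      using bz sym[OF bz(3)] by (auto simp: boundary_def)
    then have "card ?B \<le> card (boundary G (insert b S))" by (intro card_mono finB)
    moreover have "card ?B = card (boundary G S)"
      using bz(2) card.remove[OF finB b] finB[of S] by simp
    ultimately have "good (insert b S)"
      using S b connected_within_insert[OF G _ b] by (auto simp: good_def boundary_def)
    with max[of "insert b S"] b show False by (auto simp: boundary_def)
  qed
  have "boundary G S \<subseteq> pverts G - S" by (auto simp: boundary_def)
  then have "card (boundary G S) \<le> card (pverts G - S)" using fin by (intro card_mono) auto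
  with S have "card (pverts G - S) \<ge> 2" by (simp add: good_def)
  with S dom show thesis unfolding good_def by (intro that[of S]) simp_all
qed

text \<open>Upper bounds on \<open>mvc\<close> are meaningful only if some MVC-colouring exists, since \<open>Max {}\<close>
  is unspecified.  A connected graph has one: the constant colouring.\<close>

lemma mvc_connected_bounds:
  assumes "pair_graph G" "connected (with_proj G)" "card (pverts G) \<ge> 3"
  shows "3 \<le> mvc G" "mvc G \<le> card (pverts G)"
    and "(\<And>d :: 'a \<Rightarrow> nat. MVC_coloring G d \<Longrightarrow> card (d ` pverts G) \<le> k) \<Longrightarrow> mvc G \<le> k"
proof -
  have fin: "finite (pverts G)" using assms(1) by (rule pair_graph_finite)
  obtain S where S: "S \<subseteq> pverts G" "S \<noteq> {}" "connected_within G S"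
    "pverts G \<subseteq> S \<union> boundary G S" "card (pverts G - S) \<ge> 2"
    using ex_connected_dominating[OF assms] by blast
  show "3 \<le> mvc G" using mvc_ge_dominating[OF assms(1) S(1-4)] S(5) by simp
  have c: "MVC_coloring G (\<lambda>_. 0 :: nat)"
    by (rule dominating_MVC_coloring[OF assms(1) S(1,3,4)]) simp
  show "mvc G \<le> card (pverts G)" by (rule mvc_le[OF fin c]) (rule card_image_le[OF fin])
  show "mvc G \<le> k" if "\<And>d :: 'a \<Rightarrow> nat. MVC_coloring G d \<Longrightarrow> card (d ` pverts G) \<le> k"
    by (rule mvc_le[OF fin c]) (rule that)
qed

section \<open>The lower bound\<close>

text \<open>Two vertices at distance at least three have no common neighbour.  In the complement they
  are therefore adjacent, and every third vertex is joined to at least one of them.\<close>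

lemma mvc_complement_ge:
  assumes G: "pair_graph G" and far: "\<not> diameter_le_2 G"
  shows "mvc (graph_complement G) \<ge> card (pverts G) - 1"
proof -
  let ?H = "graph_complement G"
  have fin: "finite (pverts G)" using G by (rule pair_graph_finite)
  from far obtain u v where uv: "u \<in> pverts G" "v \<in> pverts G" "u \<noteq> v" "(u, v) \<notin> parcs G"
    and no_common: "\<And>w. \<not> ((u, w) \<in> parcs G \<and> (w, v) \<in> parcs G)"
    unfolding diameter_le_2_def by blast
  have H: "pair_graph ?H" by (rule pair_graph_complement[OF G])
  have "v \<in> boundary ?H {u}" using uv by (simp add: boundary_def parcs_graph_complement)
  from connected_within_insert[OF H _ this] have "connected_within ?H {v, u}"
    using connected_within_singleton[of u ?H] uv by simp
  moreover have "pverts ?H \<subseteq> {v, u} \<union> boundary ?H {v, u}"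
    using uv no_common pair_graph_arcD(1)[OF G]
    by (auto simp: boundary_def parcs_graph_complement)
  ultimately have "mvc ?H \<ge> card (pverts ?H - {v, u}) + 1"
    by (intro mvc_ge_dominating H) (use uv in auto)
  moreover have "card (pverts G - {v, u}) = card (pverts G) - 2"
    using uv fin by (subst card_Diff_subset) auto
  ultimately show ?thesis by simp
qed

lemma mvc_sum_ge:
  assumes G: "pair_graph G" and n: "card (pverts G) \<ge> 5"
    and conn: "connected (with_proj G)" "connected (with_proj (graph_complement G))"
  shows "mvc G + mvc (graph_complement G) \<ge> card (pverts G) + 3"
proof -
  let ?H = "graph_complement G"
  have H: "pair_graph ?H" by (rule pair_graph_complement[OF G])
  have three: "mvc G \<ge> 3" "mvc ?H \<ge> 3"
    using mvc_connected_bounds(1)[OF G conn(1)] mvc_connected_bounds(1)[OF H conn(2)] n by auto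
  show ?thesis
  proof (cases "diameter_le_2 G \<or> diameter_le_2 ?H")
    case True
    then show ?thesis using mvc_diameter_le_2[OF G] mvc_diameter_le_2[OF H] three by auto
  next
    case False
    then have "mvc ?H \<ge> card (pverts G) - 1" "mvc G \<ge> card (pverts G) - 1"
      using mvc_complement_ge[OF G] mvc_complement_ge[OF H] graph_complement_complement[OF G]
      by auto
    then show ?thesis using n by linarith
  qed
qed

lemma mvc_sum_le:
  assumes G: "pair_graph G" and n: "card (pverts G) \<ge> 3"
    and conn: "connected (with_proj G)" "connected (with_proj (graph_complement G))"
  shows "mvc G + mvc (graph_complement G) \<le> 2 * card (pverts G)"
  using mvc_connected_bounds(2)[OF G conn(1)] n
    mvc_connected_bounds(2)[OF pair_graph_complement[OF G] conn(2)] by simp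

section \<open>Paths attain the lower bound\<close>

definition path_graph :: "nat \<Rightarrow> nat pair_pre_digraph" where
  "path_graph n = \<lparr> pverts = {..<n},
     parcs = {(i, j). i < n \<and> j < n \<and> (j = Suc i \<or> i = Suc j)} \<rparr>"

lemma path_graph_simps [simp]:
  "pverts (path_graph n) = {..<n}"
  "(i, j) \<in> parcs (path_graph n) \<longleftrightarrow> i < n \<and> j < n \<and> (j = Suc i \<or> i = Suc j)"
  by (simp_all add: path_graph_def)

lemma pair_graph_path_graph: "pair_graph (path_graph n)"
  by (auto simp: pair_graph_iff)

lemma connected_path_graph:
  assumes "n > 0"
  shows "connected (with_proj (path_graph n))"
proof -
  have "\<exists>a\<in>T. \<exists>b\<in>{..<n} - T. (a, b) \<in> parcs (path_graph n)" if T: "T \<subset> {..<n}" "T \<noteq> {}" for T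
  proof (rule ccontr)
    assume closed: "\<not> (\<exists>a\<in>T. \<exists>b\<in>{..<n} - T. (a, b) \<in> parcs (path_graph n))"
    have step: "k \<in> T \<longleftrightarrow> Suc k \<in> T" if "Suc k < n" for k
      using closed that by (metis DiffI Suc_lessD lessThan_iff path_graph_simps(2))
    have "k \<in> T \<longleftrightarrow> 0 \<in> T" if "k < n" for k
      using that by (induction k) (use step in auto)
    then show False using T by blast
  qed
  then show ?thesis using assms connected_iff_cut[OF pair_graph_path_graph, of n] by auto
qed

text \<open>Two consecutive vertices of the path need a vertex that is consecutive to neither: \<open>0\<close>
  works if both are at least \<open>2\<close>, and otherwise both are at most \<open>2\<close> and \<open>4\<close> works.\<close>

lemma connected_complement_path_graph:
  assumes "n \<ge> 5"
  shows "connected (with_proj (graph_complement (path_graph n)))"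
proof (rule diameter_le_2_imp_connected)
  show "pair_graph (graph_complement (path_graph n))"
    by (rule pair_graph_complement[OF pair_graph_path_graph])
  show "diameter_le_2 (graph_complement (path_graph n))"
    unfolding diameter_le_2_def
  proof (intro ballI)
    fix i j assume "i \<in> pverts (graph_complement (path_graph n))"
      "j \<in> pverts (graph_complement (path_graph n))"
    then have ij: "i < n" "j < n" by auto
    consider "j = Suc i" | "i = Suc j" | "i = j \<or> (i, j) \<in> parcs (graph_complement (path_graph n))"
      using ij by (auto simp: parcs_graph_complement)
    then show "i = j \<or> (i, j) \<in> parcs (graph_complement (path_graph n)) \<or>
      (\<exists>k. (i, k) \<in> parcs (graph_complement (path_graph n)) \<and>
           (k, j) \<in> parcs (graph_complement (path_graph n)))"
    proof cases
      case 1
      have "(i, k) \<in> parcs (graph_complement (path_graph n)) \<and>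
           (k, j) \<in> parcs (graph_complement (path_graph n))"
        if "k = (if i \<ge> 2 then 0 else 4)" for k
        using that 1 ij assms by (auto simp: parcs_graph_complement)
      then show ?thesis by blast
    next
      case 2
      have "(i, k) \<in> parcs (graph_complement (path_graph n)) \<and>
           (k, j) \<in> parcs (graph_complement (path_graph n))"
        if "k = (if j \<ge> 2 then 0 else 4)" for k
        using that 2 ij assms by (auto simp: parcs_graph_complement)
      then show ?thesis by blast
    qed auto
  qed
  show "pverts (graph_complement (path_graph n)) \<noteq> {}" using assms by (auto simp: lessThan_empty_iff)
qed

text \<open>A discrete intermediate value property: one step changes the vertex by one.\<close>

lemma path_graph_walk_covers:
  assumes "vwalk p (with_proj (path_graph n))" "hd p \<le> k" "k \<le> last p"
  shows "k \<in> set p"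
  using assms
proof (induction p rule: vwalk_induct)
  case (Cons u v es)
  then show ?case by (cases "u = k") auto
qed auto

lemma mvc_path_graph_le:
  assumes "n \<ge> 3"
  shows "mvc (path_graph n) \<le> 3"
proof (rule mvc_connected_bounds(3)[OF pair_graph_path_graph connected_path_graph])
  fix c :: "nat \<Rightarrow> nat" assume "MVC_coloring (path_graph n) c"
  moreover have "0 \<in> {..<n}" "n - 1 \<in> {..<n}" using assms by auto
  ultimately obtain p where p: "vpath p (with_proj (path_graph n))" "hd p = 0" "last p = n - 1"
    and mono: "vertex_monochromatic c p"
    unfolding MVC_coloring_def path_graph_simps by blast
  have inner: "k \<in> internal_verts p" if k: "0 < k" "k < n - 1" for k
  proof -
    have walk: "vwalk p (with_proj (path_graph n))" using p(1) by (simp add: vpath_def)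
    have mem: "k \<in> set p" using path_graph_walk_covers[OF walk, of k] p k by simp
    then obtain q where q: "p = 0 # q" using p(2) by (cases p) auto
    then have "k \<in> set q" "q \<noteq> []" using mem k by auto
    moreover have "last q = n - 1" using p(3) q \<open>q \<noteq> []\<close> by simp
    ultimately have "k \<in> set (butlast q)"
      using k by (cases q rule: rev_cases) auto
    then show ?thesis by (simp add: internal_verts_def q)
  qed
  have "c k \<in> {c 0, c 1, c (n - 1)}" if "k < n" for k
  proof -
    have "k = 0 \<or> k = n - 1 \<or> 0 < k \<and> k < n - 1" using that by linarith
    then consider "k = 0" | "k = n - 1" | "0 < k" "k < n - 1" by blast
    then show ?thesis
    proof cases
      case 3
      then have "k \<in> internal_verts p" "1 \<in> internal_verts p" by (auto intro: inner)
      then have "c k = c 1" using mono unfolding vertex_monochromatic_def by blast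
      then show ?thesis by simp
    qed simp_all
  qed
  then have "c ` pverts (path_graph n) \<subseteq> {c 0, c 1, c (n - 1)}" by auto
  then have "card (c ` pverts (path_graph n)) \<le> card {c 0, c 1, c (n - 1)}"
    by (intro card_mono) auto
  also have "\<dots> \<le> 3" by (simp add: card_insert_if)
  finally show "card (c ` pverts (path_graph n)) \<le> 3" .
qed (use assms in auto)

lemma mvc_sum_path_graph:
  assumes "n \<ge> 5"
  shows "mvc (path_graph n) + mvc (graph_complement (path_graph n)) = n + 3"
proof (rule antisym)
  have "mvc (graph_complement (path_graph n)) \<le> n"
    using mvc_connected_bounds(2)[OF pair_graph_complement[OF pair_graph_path_graph]
        connected_complement_path_graph[OF assms]] assms by simp
  then show "mvc (path_graph n) + mvc (graph_complement (path_graph n)) \<le> n + 3"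
    using mvc_path_graph_le[of n] assms by simp
  show "n + 3 \<le> mvc (path_graph n) + mvc (graph_complement (path_graph n))"
    using mvc_sum_ge[OF pair_graph_path_graph _ connected_path_graph
        connected_complement_path_graph, of n] assms by simp
qed

section \<open>Twinned 5-cycles attain the upper bound\<close>

text \<open>The 5-cycle \<open>0, 1, 2, 3, 4\<close> in which the vertex \<open>4\<close>, adjacent to \<open>0\<close> and \<open>3\<close>, is
  replaced by the pairwise non-adjacent vertices \<open>4, \<dots>, n - 1\<close>.  The 5-cycle is isomorphic to its
  complement and has diameter two; the twins have the common neighbour \<open>0\<close> and are adjacent in the
  complement, so both diameters stay two.\<close>

definition twinned_pentagon :: "nat \<Rightarrow> nat pair_pre_digraph" where
  "twinned_pentagon n = \<lparr> pverts = {..<n},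
     parcs = {(i, j). i < n \<and> j < n \<and>
       {min i 4, min j 4} \<in> {{0, 1}, {1, 2}, {2, 3}, {3, 4}, {0, 4}}} \<rparr>"

lemma twinned_pentagon_simps [simp]:
  "pverts (twinned_pentagon n) = {..<n}"
  "(i, j) \<in> parcs (twinned_pentagon n) \<longleftrightarrow> i < n \<and> j < n \<and>
     {min i 4, min j 4} \<in> {{0, 1}, {1, 2}, {2, 3}, {3, 4}, {0, 4}}"
  by (simp_all add: twinned_pentagon_def)

lemma pair_graph_twinned_pentagon: "pair_graph (twinned_pentagon n)"
  by (auto simp: pair_graph_iff doubleton_eq_iff insert_commute)

lemma nat_upto_4_cases:
  fixes i :: nat
  obtains "i = 0" | "i = 1" | "i = 2" | "i = 3" | "i \<ge> 4"
  by linarith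

lemma diameter_twinned_pentagon:
  assumes "n \<ge> 5"
  shows "diameter_le_2 (twinned_pentagon n)"
proof -
  \<comment> \<open>Every vertex has the same neighbours as one of \<open>0, \<dots>, 4\<close>, so a common neighbour can be
    sought there.\<close>
  have "i = j \<or> (i, j) \<in> parcs (twinned_pentagon n) \<or>
    (\<exists>k\<in>{0, 1, 2, 3, 4}. (i, k) \<in> parcs (twinned_pentagon n) \<and> (k, j) \<in> parcs (twinned_pentagon n))"
    if "i < n" "j < n" for i j
    using that assms
    by (cases i rule: nat_upto_4_cases; cases j rule: nat_upto_4_cases) (simp_all add: doubleton_eq_iff)
  then show ?thesis unfolding diameter_le_2_def by (metis lessThan_iff twinned_pentagon_simps(1))
qed

lemma diameter_complement_twinned_pentagon:
  assumes "n \<ge> 5"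
  shows "diameter_le_2 (graph_complement (twinned_pentagon n))"
proof -
  let ?H = "graph_complement (twinned_pentagon n)"
  have "i = j \<or> (i, j) \<in> parcs ?H \<or> (\<exists>k\<in>{0, 1, 2, 3, 4}. (i, k) \<in> parcs ?H \<and> (k, j) \<in> parcs ?H)"
    if "i < n" "j < n" for i j
    using that assms
    by (cases i rule: nat_upto_4_cases; cases j rule: nat_upto_4_cases)
      (simp_all add: doubleton_eq_iff parcs_graph_complement)
  then show ?thesis unfolding diameter_le_2_def
    by (metis lessThan_iff twinned_pentagon_simps(1) pverts_graph_complement)
qed

theorem theorem4p2:
  fixes n :: nat
  assumes "n \<ge> 5"
  shows "(\<forall>G :: 'a pair_pre_digraph.
            pair_graph G \<and> card (pverts G) = n \<and>
            connected (with_proj G) \<and> connected (with_proj (graph_complement G)) \<longrightarrow>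
            n + 3 \<le> mvc G + mvc (graph_complement G) \<and>
            mvc G + mvc (graph_complement G) \<le> 2 * n)
       \<and> (\<exists>G :: nat pair_pre_digraph.
            pair_graph G \<and> card (pverts G) = n \<and>
            connected (with_proj G) \<and> connected (with_proj (graph_complement G)) \<and>
            mvc G + mvc (graph_complement G) = n + 3)
       \<and> (\<exists>G :: nat pair_pre_digraph.
            pair_graph G \<and> card (pverts G) = n \<and>
            connected (with_proj G) \<and> connected (with_proj (graph_complement G)) \<and>
            mvc G + mvc (graph_complement G) = 2 * n)"
proof (intro conjI)
  show "\<forall>G :: 'a pair_pre_digraph.
      pair_graph G \<and> card (pverts G) = n \<and>
      connected (with_proj G) \<and> connected (with_proj (graph_complement G)) \<longrightarrow>
      n + 3 \<le> mvc G + mvc (graph_complement G) \<and>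
      mvc G + mvc (graph_complement G) \<le> 2 * n"
    using mvc_sum_ge mvc_sum_le assms by fastforce
next
  show "\<exists>G :: nat pair_pre_digraph.
      pair_graph G \<and> card (pverts G) = n \<and>
      connected (with_proj G) \<and> connected (with_proj (graph_complement G)) \<and>
      mvc G + mvc (graph_complement G) = n + 3"
    using pair_graph_path_graph[of n] connected_path_graph[of n]
      connected_complement_path_graph[OF assms] mvc_sum_path_graph[OF assms] assms
    by (intro exI[of _ "path_graph n"]) simp
next
  let ?G = "twinned_pentagon n"
  have G: "pair_graph ?G" "pair_graph (graph_complement ?G)"
    using pair_graph_twinned_pentagon pair_graph_complement by auto
  note diam = diameter_twinned_pentagon[OF assms] diameter_complement_twinned_pentagon[OF assms]
  have nonempty: "{..<n} \<noteq> {}" using assms by (auto simp: lessThan_empty_iff)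
  have conn: "connected (with_proj ?G)" "connected (with_proj (graph_complement ?G))"
    using diameter_le_2_imp_connected[OF G(1) diam(1)] diameter_le_2_imp_connected[OF G(2) diam(2)]
      nonempty by simp_all
  have "mvc ?G + mvc (graph_complement ?G) = 2 * n"
    using mvc_diameter_le_2[OF G(1) diam(1)] mvc_diameter_le_2[OF G(2) diam(2)]
      mvc_sum_le[OF G(1) _ conn] assms by simp
  then show "\<exists>G :: nat pair_pre_digraph.
      pair_graph G \<and> card (pverts G) = n \<and>
      connected (with_proj G) \<and> connected (with_proj (graph_complement G)) \<and>
      mvc G + mvc (graph_complement G) = 2 * n"
    using G conn by (intro exI[of _ ?G]) simp
qed

end
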